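(* Let $X$ be a functionally Hausdorff space. Then the following conditions are equivalent: (1) the free paratopological group $FP(X)$ is of almost countable type; (2) the free Abelian paratopological group $AP(X)$ is of almost countable type; (3) the space $X$ is discrete.
   Context: All spaces are assumed to be $T_0$. A paratopological group is a group with a topology such that multiplication $G\times G\to G$ is continuous (inversion need not be continuous). The (Markov) free paratopological group $FP(X)$ on a space $X$ is the paratopological group $G$ that contains $X$ as a subspace, is algebraically generated by $X$, and is such that every continuous map $f:X\to H$ to a paratopological group $H$ extends to a continuous homomorphism $\hat f:G\to H$; its underlying group is the abstract free group on $X$. The free Abelian paratopological group $AP(X)$ is defined in the same way with all groups Abelian; its underlying group is the free Abelian group on $X$. A space $X$ is functionally Hausdorff if for any two distinct points $x,y\in X$ there is a continuous $f:X\to\mathbb{R}$ with $f(x)\neq f(y)$. A subset $K$ of a space $Y$ is of countable character in $Y$ if there is a countable family of open sets containing $K$ such that every open set containing $K$ contains a member of the family. A space $Y$ is of almost countable type if it contains a non-empty compact set $K$ that is of countable character in $Y$. *)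

theory Defs
  imports "HOL-Analysis.Analysis" "HOL-Algebra.Generated_Groups" "HOL-Algebra.Product_Groups"
begin

definition functionally_Hausdorff :: "'a topology \<Rightarrow> bool" where
  "functionally_Hausdorff X \<longleftrightarrow>
     (\<forall>x \<in> topspace X. \<forall>y \<in> topspace X. x \<noteq> y \<longrightarrow>
        (\<exists>f :: 'a \<Rightarrow> real. continuous_map X euclideanreal f \<and> f x \<noteq> f y))"

definition countable_character_in :: "'a topology \<Rightarrow> 'a set \<Rightarrow> bool" where
  "countable_character_in Y K \<longleftrightarrow>
     (\<exists>\<B>. countable \<B> \<and> (\<forall>B \<in> \<B>. openin Y B \<and> K \<subseteq> B) \<and>
          (\<forall>U. openin Y U \<and> K \<subseteq> U \<longrightarrow> (\<exists>B \<in> \<B>. B \<subseteq> U)))"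

definition almost_countable_type :: "'a topology \<Rightarrow> bool" where
  "almost_countable_type Y \<longleftrightarrow>
     (\<exists>K. K \<noteq> {} \<and> compactin Y K \<and> countable_character_in Y K)"

text \<open>All spaces are assumed to be \<open>T\<^sub>0\<close>, so this is part of the definition.\<close>

definition paratopological_group :: "'g monoid \<Rightarrow> 'g topology \<Rightarrow> bool" where
  "paratopological_group G T \<longleftrightarrow>
     group G \<and> topspace T = carrier G \<and> t0_space T \<and>
     continuous_map (prod_topology T T) T (\<lambda>(a, b). a \<otimes>\<^bsub>G\<^esub> b)"

text \<open>
  \<open>(G, T)\<close> together with \<open>e\<close> is a (Markov) free paratopological group on \<open>X\<close>. The containment
  of \<open>X\<close> in \<open>G\<close> as a subspace is given by the topological embedding \<open>e\<close>; literal containment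
  is the case where \<open>e\<close> is the identity.

  A definition in HOL cannot quantify over the type of the elements of \<open>H\<close>. It is
  enough to let \<open>H\<close> range over the paratopological groups whose elements are words in the letters
  \<open>x\<close> and \<open>x\<^sup>-\<^sup>1\<close>, because the subgroup of an arbitrary \<open>H\<close> generated by the image
  of \<open>X\<close> has at most as many elements as there are such words. The extension property for
  groups \<open>H\<close> over any type is proved below as \<open>free_paratopological_group_extension\<close> and
  \<open>free_abelian_paratopological_group_extension\<close>.
\<close>

definition free_paratopological_group ::
    "'a topology \<Rightarrow> 'g monoid \<Rightarrow> 'g topology \<Rightarrow> ('a \<Rightarrow> 'g) \<Rightarrow> bool" where
  "free_paratopological_group X G T e \<longleftrightarrow>
     paratopological_group G T \<and>
     embedding_map X T e \<and>
     generate G (e ` topspace X) = carrier G \<and>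
     (\<forall>(H :: ('a \<times> bool) list monoid) S f.
        paratopological_group H S \<and> continuous_map X S f \<longrightarrow>
        (\<exists>h. h \<in> hom G H \<and> continuous_map T S h \<and> (\<forall>x \<in> topspace X. h (e x) = f x)))"

definition free_abelian_paratopological_group ::
    "'a topology \<Rightarrow> 'g monoid \<Rightarrow> 'g topology \<Rightarrow> ('a \<Rightarrow> 'g) \<Rightarrow> bool" where
  "free_abelian_paratopological_group X G T e \<longleftrightarrow>
     paratopological_group G T \<and> comm_group G \<and>
     embedding_map X T e \<and>
     generate G (e ` topspace X) = carrier G \<and>
     (\<forall>(H :: ('a \<times> bool) list monoid) S f.
        paratopological_group H S \<and> comm_group H \<and> continuous_map X S f \<longrightarrow>
        (\<exists>h. h \<in> hom G H \<and> continuous_map T S h \<and> (\<forall>x \<in> topspace X. h (e x) = f x)))"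


section \<open>The extension property for groups over arbitrary types\<close>

text \<open>The two cases are treated together; the flag \<open>ab\<close> selects the Abelian one.\<close>

definition free_pt :: "bool \<Rightarrow> 'a topology \<Rightarrow> 'g monoid \<Rightarrow> 'g topology \<Rightarrow> ('a \<Rightarrow> 'g) \<Rightarrow> bool" where
  "free_pt ab X G T e \<longleftrightarrow>
     paratopological_group G T \<and> (ab \<longrightarrow> comm_group G) \<and>
     embedding_map X T e \<and>
     generate G (e ` topspace X) = carrier G \<and>
     (\<forall>(H :: ('a \<times> bool) list monoid) S f.
        paratopological_group H S \<and> (ab \<longrightarrow> comm_group H) \<and> continuous_map X S f \<longrightarrow>
        (\<exists>h. h \<in> hom G H \<and> continuous_map T S h \<and> (\<forall>x \<in> topspace X. h (e x) = f x)))"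

lemma free_pt_iff:
  "free_pt False X G T e \<longleftrightarrow> free_paratopological_group X G T e"
  "free_pt True X G T e \<longleftrightarrow> free_abelian_paratopological_group X G T e"
  by (auto simp: free_pt_def free_paratopological_group_def free_abelian_paratopological_group_def)

lemma paratopological_subgroup_copy:
  fixes H :: "'h monoid" and p :: "'w \<Rightarrow> 'h"
  assumes H: "paratopological_group H S" and K: "subgroup K H" and p: "bij_betw p R K"
  obtains H' :: "'w monoid" and S' where
    "paratopological_group H' S'" "comm_group H \<longrightarrow> comm_group H'"
    "p \<in> hom H' H" "continuous_map S' S p" "topspace S' = R"
    "\<And>(X :: 'a topology) g. continuous_map X S g \<Longrightarrow> g ` topspace X \<subseteq> K \<Longrightarrow>
       continuous_map X S' (inv_into R p \<circ> g)"
proof -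
  define q where "q = inv_into R p"
  define H' where "H' = \<lparr>carrier = R, monoid.mult = (\<lambda>a b. q (p a \<otimes>\<^bsub>H\<^esub> p b)), one = q \<one>\<^bsub>H\<^esub>\<rparr>"
  define S' where "S' = pullback_topology R p S"
  interpret H: group H using H by (simp add: paratopological_group_def)
  have top: "topspace S = carrier H" "t0_space S"
    and mult: "continuous_map (prod_topology S S) S (\<lambda>(a, b). a \<otimes>\<^bsub>H\<^esub> b)"
    using H by (auto simp: paratopological_group_def)
  have KH: "K \<subseteq> carrier H" using K by (rule subgroup.subset)
  have pK [simp]: "p a \<in> K" if "a \<in> R" for a using p that by (auto simp: bij_betw_def)
  have pH [simp]: "p a \<in> carrier H" if "a \<in> R" for a using KH pK that by blast
  have qR [simp]: "q k \<in> R" if "k \<in> K" for k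
    using p that by (metis bij_betw_def inv_into_into q_def)
  have pq [simp]: "p (q k) = k" if "k \<in> K" for k
    using p that by (metis bij_betw_inv_into_right q_def)
  have qp [simp]: "q (p a) = a" if "a \<in> R" for a
    using p that by (metis bij_betw_inv_into_left q_def)
  have Km [simp]: "a \<otimes>\<^bsub>H\<^esub> b \<in> K" if "a \<in> K" "b \<in> K" for a b
    using K that by (rule subgroup.m_closed)
  have K1 [simp]: "\<one>\<^bsub>H\<^esub> \<in> K" using K by (rule subgroup.one_closed)
  have Ki [simp]: "inv\<^bsub>H\<^esub> a \<in> K" if "a \<in> K" for a
    using K that by (rule subgroup.m_inv_closed)
  have grp: "group H'"
  proof (rule groupI)
    fix x assume x: "x \<in> carrier H'"
    then show "\<exists>y\<in>carrier H'. y \<otimes>\<^bsub>H'\<^esub> x = \<one>\<^bsub>H'\<^esub>"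
      by (intro bexI [of _ "q (inv\<^bsub>H\<^esub> p x)"]) (auto simp: H'_def)
  qed (auto simp: H'_def H.m_assoc)
  have comm: "comm_group H'" if "comm_group H"
  proof (rule group.group_comm_groupI [OF grp])
    interpret C: comm_group H by (rule that)
    fix x y assume "x \<in> carrier H'" "y \<in> carrier H'"
    then show "x \<otimes>\<^bsub>H'\<^esub> y = y \<otimes>\<^bsub>H'\<^esub> x"
      by (auto simp: H'_def C.m_comm)
  qed
  have hom: "p \<in> hom H' H" by (auto simp: hom_def H'_def)
  have topS': "topspace S' = R"
    using pH top by (auto simp: S'_def topspace_pullback_topology)
  have cont: "continuous_map S' S p"
    using continuous_map_pullback [of S S "\<lambda>x. x" R p] by (simp add: S'_def comp_def)
  have lift: "continuous_map X S' g"
    if "continuous_map X S (p \<circ> g)" "g ` topspace X \<subseteq> R" for X :: "'z topology" and g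
    unfolding S'_def using that by (intro continuous_map_pullback') auto
  have t0: "t0_space S'"
    unfolding t0_space_def topS'
  proof (intro ballI impI)
    fix x y assume xy: "x \<in> R" "y \<in> R" "x \<noteq> y"
    then have "p x \<noteq> p y" by (metis qp)
    then obtain U where U: "openin S U" "p x \<notin> U \<longleftrightarrow> p y \<in> U"
      using top xy unfolding t0_space_def by (metis pH)
    then have "openin S' (p -` U \<inter> R)" by (auto simp: S'_def openin_pullback_topology)
    then show "\<exists>U. openin S' U \<and> (x \<notin> U) = (y \<in> U)"
      using U xy by (intro exI [of _ "p -` U \<inter> R"]) auto
  qed
  have mult': "continuous_map (prod_topology S' S') S' (\<lambda>(a, b). a \<otimes>\<^bsub>H'\<^esub> b)"
  proof (rule lift)
    have "continuous_map (prod_topology S' S') (prod_topology S S) (\<lambda>(a, b). (p a, p b))"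
      using cont by (simp add: continuous_map_prod_top)
    then have "continuous_map (prod_topology S' S') S
        ((\<lambda>(a, b). a \<otimes>\<^bsub>H\<^esub> b) \<circ> (\<lambda>(a, b). (p a, p b)))"
      using mult by (rule continuous_map_compose)
    then show "continuous_map (prod_topology S' S') S (p \<circ> (\<lambda>(a, b). a \<otimes>\<^bsub>H'\<^esub> b))"
      by (rule continuous_map_eq) (auto simp: topS' H'_def)
  qed (auto simp: topS' H'_def)
  show ?thesis
  proof (rule that [of H' S'])
    show "paratopological_group H' S'"
      using grp topS' t0 mult' by (simp add: paratopological_group_def H'_def)
    show "continuous_map X S' (inv_into R p \<circ> g)"
      if g: "continuous_map X S g" "g ` topspace X \<subseteq> K" for X :: "'a topology" and g
    proof (rule lift)
      show "continuous_map X S (p \<circ> (inv_into R p \<circ> g))"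
        using g(1) by (rule continuous_map_eq) (use g in \<open>auto simp: q_def [symmetric]\<close>)
    qed (use g in \<open>auto simp: q_def [symmetric]\<close>)
  qed (use comm hom cont topS' in auto)
qed

text \<open>Evaluation of words; \<open>(x, True)\<close> stands for \<open>x\<close> and \<open>(x, False)\<close> for \<open>x\<^sup>-\<^sup>1\<close>.\<close>

primrec word_eval :: "'h monoid \<Rightarrow> ('a \<Rightarrow> 'h) \<Rightarrow> ('a \<times> bool) list \<Rightarrow> 'h" where
  "word_eval H f [] = \<one>\<^bsub>H\<^esub>"
| "word_eval H f (l # w) =
     (if snd l then f (fst l) else inv\<^bsub>H\<^esub> f (fst l)) \<otimes>\<^bsub>H\<^esub> word_eval H f w"

lemma generate_subset_word_eval:
  assumes "group H" "f ` A \<subseteq> carrier H"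
  shows "generate H (f ` A) \<subseteq> word_eval H f ` lists (A \<times> UNIV)"
proof
  interpret group H by fact
  have car: "word_eval H f w \<in> carrier H" if "w \<in> lists (A \<times> UNIV)" for w
    using that assms(2) by (induction w) auto
  have app: "word_eval H f (v @ w) = word_eval H f v \<otimes>\<^bsub>H\<^esub> word_eval H f w"
    if "v \<in> lists (A \<times> UNIV)" "w \<in> lists (A \<times> UNIV)" for v w
    using that(1) 
  proof (induction v)
    case Nil
    then show ?case using car that by simp
  next
    case (Cons l v)
    have "(if snd l then f (fst l) else inv\<^bsub>H\<^esub> f (fst l)) \<in> carrier H"
      using Cons.hyps assms(2) by auto
    then show ?case using Cons car that by (simp add: m_assoc)
  qed
  fix g assume "g \<in> generate H (f ` A)"
  then show "g \<in> word_eval H f ` lists (A \<times> UNIV)"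
  proof induction
    case one
    then show ?case by (intro image_eqI [of _ _ "[]"]) auto
  next
    case (incl h)
    then obtain a where "a \<in> A" "h = f a" by blast
    then show ?case using assms(2) by (intro image_eqI [of _ _ "[(a, True)]"]) auto
  next
    case (inv h)
    then obtain a where "a \<in> A" "h = f a" by blast
    then show ?case using assms(2) by (intro image_eqI [of _ _ "[(a, False)]"]) auto
  next
    case (eng h1 h2)
    then obtain v w where "v \<in> lists (A \<times> UNIV)" "w \<in> lists (A \<times> UNIV)"
      "h1 = word_eval H f v" "h2 = word_eval H f w" by blast
    then show ?case by (intro image_eqI [of _ _ "v @ w"]) (auto simp: app)
  qed
qed

lemma generated_paratopological_copy:
  fixes H :: "'h monoid" and X :: "'a topology"
  assumes H: "paratopological_group H S" and f: "continuous_map X S f"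
  obtains H' :: "('a \<times> bool) list monoid" and S' p f' where
    "paratopological_group H' S'" "comm_group H \<longrightarrow> comm_group H'"
    "p \<in> hom H' H" "continuous_map S' S p" "continuous_map X S' f'"
    "\<forall>x \<in> topspace X. p (f' x) = f x"
proof -
  define K where "K = generate H (f ` topspace X)"
  have grp: "group H" and top: "topspace S = carrier H"
    using H by (auto simp: paratopological_group_def)
  have img: "f ` topspace X \<subseteq> carrier H"
    using f top by (metis continuous_map_image_subset_topspace)
  have "K \<subseteq> word_eval H f ` lists (topspace X \<times> UNIV)"
    unfolding K_def by (rule generate_subset_word_eval [OF grp img])
  then obtain R where R: "inj_on (word_eval H f) R" "K = word_eval H f ` R"
    by (auto simp: subset_image_inj)
  then have bij: "bij_betw (word_eval H f) R K" by (simp add: bij_betw_def)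
  have sub: "subgroup K H"
    unfolding K_def by (rule group.generate_is_subgroup [OF grp img])
  have fK: "f ` topspace X \<subseteq> K" unfolding K_def by (auto intro: generate.incl)
  obtain H' :: "('a \<times> bool) list monoid" and S' where *:
    "paratopological_group H' S'" "comm_group H \<longrightarrow> comm_group H'"
    "word_eval H f \<in> hom H' H" "continuous_map S' S (word_eval H f)"
    "\<And>(X :: 'a topology) g. continuous_map X S g \<Longrightarrow> g ` topspace X \<subseteq> K \<Longrightarrow>
       continuous_map X S' (inv_into R (word_eval H f) \<circ> g)"
    using paratopological_subgroup_copy [OF H sub bij, where ?'a = 'a] by metis
  show ?thesis
  proof (rule that [OF *(1-4) *(5) [OF f fK]])
    show "\<forall>x \<in> topspace X. word_eval H f ((inv_into R (word_eval H f) \<circ> f) x) = f x"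
      using bij fK by (simp add: bij_betw_inv_into_right image_subset_iff)
  qed
qed

lemma free_pt_extension:
  fixes H :: "'h monoid" and X :: "'a topology"
  assumes G: "free_pt ab X G T e"
    and H: "paratopological_group H S" "ab \<longrightarrow> comm_group H" and f: "continuous_map X S f"
  shows "\<exists>h. h \<in> hom G H \<and> continuous_map T S h \<and> (\<forall>x \<in> topspace X. h (e x) = f x)"
proof -
  obtain H' :: "('a \<times> bool) list monoid" and S' p f' where *:
    "paratopological_group H' S'" "comm_group H \<longrightarrow> comm_group H'"
    "p \<in> hom H' H" "continuous_map S' S p" "continuous_map X S' f'"
    "\<forall>x \<in> topspace X. p (f' x) = f x"
    by (rule generated_paratopological_copy [OF H(1) f]) (rule that)
  have "\<forall>(H :: ('a \<times> bool) list monoid) S f.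
      paratopological_group H S \<and> (ab \<longrightarrow> comm_group H) \<and> continuous_map X S f \<longrightarrow>
      (\<exists>h. h \<in> hom G H \<and> continuous_map T S h \<and> (\<forall>x \<in> topspace X. h (e x) = f x))"
    using G unfolding free_pt_def by (elim conjE)
  moreover have "paratopological_group H' S' \<and> (ab \<longrightarrow> comm_group H') \<and> continuous_map X S' f'"
    using * H(2) by blast
  ultimately have "\<exists>h. h \<in> hom G H' \<and> continuous_map T S' h \<and> (\<forall>x \<in> topspace X. h (e x) = f' x)"
    by (elim allE [of _ H'] allE [of _ S'] allE [of _ f'] mp)
  then obtain h where h: "h \<in> hom G H'" "continuous_map T S' h" "\<forall>x \<in> topspace X. h (e x) = f' x"
    by (elim exE conjE) (rule that)
  have "p \<circ> h \<in> hom G H" using h(1) *(3) by (rule hom_compose)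
  moreover have "continuous_map T S (p \<circ> h)" using h(2) *(4) by (rule continuous_map_compose)
  ultimately show ?thesis using h(3) *(6) by (intro exI [of _ "p \<circ> h"]) auto
qed

theorem free_paratopological_group_extension:
  fixes H :: "'h monoid"
  assumes "free_paratopological_group X G T e"
    and "paratopological_group H S" and "continuous_map X S f"
  shows "\<exists>h. h \<in> hom G H \<and> continuous_map T S h \<and> (\<forall>x \<in> topspace X. h (e x) = f x)"
  using free_pt_extension [of False X G T e H S f] assms by (simp add: free_pt_iff)

theorem free_abelian_paratopological_group_extension:
  fixes H :: "'h monoid"
  assumes "free_abelian_paratopological_group X G T e"
    and "paratopological_group H S" "comm_group H" and "continuous_map X S f"
  shows "\<exists>h. h \<in> hom G H \<and> continuous_map T S h \<and> (\<forall>x \<in> topspace X. h (e x) = f x)"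
  using free_pt_extension [of True X G T e H S f] assms by (simp add: free_pt_iff)


section \<open>Existence\<close>

text \<open>The integers with the topology of upper sets separate points from closed sets.\<close>

lemma upper_integers:
  obtains Z :: "int monoid" and S where
    "paratopological_group Z S" "comm_group Z"
    "\<And>(X :: 'a topology) U. openin X U \<Longrightarrow> continuous_map X S (\<lambda>x. if x \<in> U then 1 else 0)"
    "openin S {1..}"
proof -
  define S :: "int topology" where "S = topology (\<lambda>U. \<forall>a b. a \<in> U \<and> a \<le> b \<longrightarrow> b \<in> U)"
  define Z :: "int monoid" where "Z = \<lparr>carrier = UNIV, monoid.mult = (+), one = 0\<rparr>"
  have op: "openin S U \<longleftrightarrow> (\<forall>a b. a \<in> U \<and> a \<le> b \<longrightarrow> b \<in> U)" for U
  proof -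
    have "istopology (\<lambda>U :: int set. \<forall>a b. a \<in> U \<and> a \<le> b \<longrightarrow> b \<in> U)"
      unfolding istopology_def by blast
    then show ?thesis by (simp add: S_def topology_inverse')
  qed
  have top: "topspace S = UNIV"
    using op [of UNIV] by (metis UNIV_I openin_subset top.extremum_uniqueI)
  have grp: "comm_group Z"
  proof (rule comm_groupI)
    show "\<exists>y\<in>carrier Z. y \<otimes>\<^bsub>Z\<^esub> x = \<one>\<^bsub>Z\<^esub>" for x
      by (rule bexI [of _ "- x"]) (simp_all add: Z_def)
  qed (simp_all add: Z_def)
  have t0: "t0_space S"
    unfolding t0_space_def
  proof (intro ballI impI)
    fix x y :: int assume "x \<noteq> y"
    then show "\<exists>U. openin S U \<and> (x \<notin> U) = (y \<in> U)"
      by (intro exI [of _ "{max x y..}"]) (auto simp: op)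
  qed
  have "continuous_map (prod_topology S S) S (\<lambda>(a, b). a + b)"
    unfolding continuous_map_def
  proof (intro conjI allI impI)
    fix U assume U: "openin S U"
    show "openin (prod_topology S S) {x \<in> topspace (prod_topology S S). (case x of (a, b) \<Rightarrow> a + b) \<in> U}"
      unfolding openin_prod_topology_alt
    proof (intro allI impI)
      fix a b assume "(a, b) \<in> {x \<in> topspace (prod_topology S S). (case x of (a, b) \<Rightarrow> a + b) \<in> U}"
      then have ab: "a + b \<in> U" by simp
      have "c + d \<in> U" if "a \<le> c" "b \<le> d" for c d
        using U ab that unfolding op by (meson add_mono)
      then show "\<exists>V W. openin S V \<and> openin S W \<and> a \<in> V \<and> b \<in> W \<and>
          V \<times> W \<subseteq> {x \<in> topspace (prod_topology S S). (case x of (a, b) \<Rightarrow> a + b) \<in> U}"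
        by (intro exI [of _ "{a..}"] exI [of _ "{b..}"]) (auto simp: op top)
    qed
  qed (auto simp: top)
  then have para: "paratopological_group Z S"
    using grp t0 top by (simp add: paratopological_group_def Z_def comm_group.axioms(2))
  show ?thesis
  proof (rule that [OF para grp])
    fix X :: "'a topology" and U assume U: "openin X U"
    show "continuous_map X S (\<lambda>x. if x \<in> U then 1 else 0)"
      unfolding continuous_map_def
    proof (intro conjI allI impI)
      fix V assume V: "openin S V"
      have "{x \<in> topspace X. (if x \<in> U then 1 else 0) \<in> V} =
          (if 0 \<in> V then topspace X else if 1 \<in> V then U else {})"
      proof -
        have "1 \<in> V" if "0 \<in> V"
          using V that unfolding op by (metis zero_le_one)
        then show ?thesis using openin_subset [OF U] by auto
      qed
      then show "openin X {x \<in> topspace X. (if x \<in> U then 1 else 0) \<in> V}"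
        using U by simp
    qed (auto simp: top)
  qed (auto simp: op)
qed

lemma free_pt_exists:
  fixes X :: "'a topology"
  assumes X: "t0_space X"
  obtains G :: "(('a \<times> bool) list monoid \<times> ('a \<times> bool) list topology \<times> ('a \<Rightarrow> ('a \<times> bool) list)
      \<Rightarrow> ('a \<times> bool) list) monoid" and T e
  where "free_pt ab X G T e"
proof -
  define I :: "(('a \<times> bool) list monoid \<times> ('a \<times> bool) list topology \<times> ('a \<Rightarrow> ('a \<times> bool) list)) set"
    where "I = {(H, S, f). paratopological_group H S \<and> (ab \<longrightarrow> comm_group H) \<and> continuous_map X S f}"
  define P where "P = product_group I fst"
  define TP where "TP = product_topology (\<lambda>i. fst (snd i)) I"
  define e where "e x = (\<lambda>i\<in>I. snd (snd i) x)" for x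
  define K where "K = generate P (e ` topspace X)"
  define G where "G = P\<lparr>carrier := K\<rparr>"
  define T where "T = subtopology TP K"
  have I: "group (fst i)" "topspace (fst (snd i)) = carrier (fst i)" "t0_space (fst (snd i))"
      "continuous_map (prod_topology (fst (snd i)) (fst (snd i))) (fst (snd i))
         (\<lambda>(a, b). a \<otimes>\<^bsub>fst i\<^esub> b)"
      "ab \<longrightarrow> comm_group (fst i)" "continuous_map X (fst (snd i)) (snd (snd i))"
    if "i \<in> I" for i
    using that by (auto simp: I_def paratopological_group_def)
  have grpP: "group P" unfolding P_def by (simp add: I)
  have carP: "carrier P = (\<Pi>\<^sub>E i\<in>I. carrier (fst i))" by (simp add: P_def)
  have topP: "topspace TP = carrier P"
    unfolding TP_def carP topspace_product_topology comp_def by (rule PiE_cong) (simp add: I)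
  have cont_e: "continuous_map X TP e"
    unfolding TP_def continuous_map_componentwise e_def by (auto simp: I)
  then have img: "e ` topspace X \<subseteq> carrier P"
    using topP by (metis continuous_map_image_subset_topspace)
  have subK: "subgroup K P" unfolding K_def by (rule group.generate_is_subgroup [OF grpP img])
  have KP: "K \<subseteq> carrier P" using subK by (rule subgroup.subset)
  have eK: "e ` topspace X \<subseteq> K" unfolding K_def by (auto intro: generate.incl)
  have grpG: "group G" unfolding G_def by (rule subgroup.subgroup_is_group [OF subK grpP])
  have topT: "topspace T = carrier G" using topP KP by (auto simp: T_def G_def)
  have proj: "continuous_map T (fst (snd i)) (\<lambda>a. a i)" if "i \<in> I" for i
    unfolding T_def TP_def using that
    by (intro continuous_map_from_subtopology continuous_map_product_projection)
  have comm: "comm_group G" if ab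
  proof (rule group.group_comm_groupI [OF grpG])
    fix a b assume "a \<in> carrier G" "b \<in> carrier G"
    then have "a \<in> carrier P" "b \<in> carrier P" using KP by (auto simp: G_def)
    then have "a i \<otimes>\<^bsub>fst i\<^esub> b i = b i \<otimes>\<^bsub>fst i\<^esub> a i" if "i \<in> I" for i
      using I(5) [OF that] that \<open>ab\<close> unfolding carP
      by (intro comm_monoid.m_comm comm_group.axioms(1)) auto
    then show "a \<otimes>\<^bsub>G\<^esub> b = b \<otimes>\<^bsub>G\<^esub> a" by (auto simp: G_def P_def)
  qed
  have t0: "t0_space T"
    unfolding t0_space_def
  proof (intro ballI impI)
    fix a b assume ab: "a \<in> topspace T" "b \<in> topspace T" "a \<noteq> b"
    have car: "a \<in> (\<Pi>\<^sub>E i\<in>I. carrier (fst i))" "b \<in> (\<Pi>\<^sub>E i\<in>I. carrier (fst i))"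
      using ab KP topT carP by (auto simp: G_def)
    have "\<exists>i\<in>I. a i \<noteq> b i"
    proof (rule ccontr)
      assume "\<not> (\<exists>i\<in>I. a i \<noteq> b i)"
      then have "a = b" by (intro PiE_ext [OF car]) blast
      with ab(3) show False by contradiction
    qed
    then obtain i where i: "i \<in> I" "a i \<noteq> b i" by blast
    then have "a i \<in> carrier (fst i)" "b i \<in> carrier (fst i)"
      using car by (auto dest: PiE_mem)
    note i = i this
    then obtain U where U: "openin (fst (snd i)) U" "(a i \<notin> U) = (b i \<in> U)"
      using I(2,3) [OF i(1)] unfolding t0_space_def by metis
    have "openin T {c \<in> topspace T. c i \<in> U}"
      using proj [OF i(1)] U(1) by (rule openin_continuous_map_preimage)
    then show "\<exists>U. openin T U \<and> (a \<notin> U) = (b \<in> U)"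
      using U(2) ab by (intro exI [of _ "{c \<in> topspace T. c i \<in> U}"]) auto
  qed
  have mult: "continuous_map (prod_topology T T) T (\<lambda>(a, b). a \<otimes>\<^bsub>G\<^esub> b)"
  proof -
    have "continuous_map (prod_topology T T) TP (\<lambda>x. fst x \<otimes>\<^bsub>G\<^esub> snd x)"
      unfolding TP_def continuous_map_componentwise
    proof (intro conjI ballI)
      fix i assume i: "i \<in> I"
      have "continuous_map (prod_topology T T) (prod_topology (fst (snd i)) (fst (snd i)))
          (\<lambda>x. (fst x i, snd x i))"
        using continuous_map_compose [OF continuous_map_fst proj [OF i], of T]
          continuous_map_compose [OF continuous_map_snd proj [OF i], of T]
        by (auto simp: comp_def intro!: continuous_map_pairedI)
      from continuous_map_compose [OF this I(4) [OF i]]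
      show "continuous_map (prod_topology T T) (fst (snd i)) (\<lambda>x. (fst x \<otimes>\<^bsub>G\<^esub> snd x) i)"
        using i by (simp add: comp_def G_def P_def)
    qed (auto simp: G_def P_def)
    moreover have "fst x \<otimes>\<^bsub>G\<^esub> snd x \<in> K" if "x \<in> topspace (prod_topology T T)" for x
      using that subgroup.m_closed [OF subK] topT by (auto simp: G_def)
    ultimately show ?thesis
      by (auto simp: T_def continuous_map_in_subtopology case_prod_unfold)
  qed
  have ext: "\<exists>h. h \<in> hom G H \<and> continuous_map T S h \<and> (\<forall>x \<in> topspace X. h (e x) = f x)"
    if "paratopological_group H S \<and> (ab \<longrightarrow> comm_group H) \<and> continuous_map X S f"
    for H :: "('a \<times> bool) list monoid" and S f
  proof -
    have i: "(H, S, f) \<in> I" using that by (simp add: I_def)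
    have "(\<lambda>a. a (H, S, f)) \<in> hom G H"
    proof (rule homI)
      fix a assume "a \<in> carrier G"
      then show "a (H, S, f) \<in> carrier H" using KP i by (force simp: G_def carP)
    qed (use i in \<open>auto simp: G_def P_def\<close>)
    then show ?thesis using proj [OF i] i by (intro exI [of _ "\<lambda>a. a (H, S, f)"]) (auto simp: e_def)
  qed
  have cont_eT: "continuous_map X T e"
    using cont_e eK by (auto simp: T_def continuous_map_in_subtopology)
  have sep: "\<exists>V. openin T V \<and> (\<forall>x \<in> topspace X. e x \<in> V \<longleftrightarrow> x \<in> U)" if U: "openin X U" for U
  proof -
    obtain Z :: "int monoid" and S where Z: "paratopological_group Z S" "comm_group Z"
      "continuous_map X S (\<lambda>x. if x \<in> U then 1 else 0)" "openin S {1..}"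
      using upper_integers [where ?'a = 'a] U by metis
    obtain H' :: "('a \<times> bool) list monoid" and S' p f' where *:
      "paratopological_group H' S'" "comm_group Z \<longrightarrow> comm_group H'"
      "p \<in> hom H' Z" "continuous_map S' S p" "continuous_map X S' f'"
      "\<forall>x \<in> topspace X. p (f' x) = (if x \<in> U then 1 else 0)"
      by (rule generated_paratopological_copy [OF Z(1,3)]) (rule that)
    then obtain h where h: "continuous_map T S' h" "\<forall>x \<in> topspace X. h (e x) = f' x"
      using ext [of H' S' f'] Z(2) by blast
    have "continuous_map T S (p \<circ> h)" using h(1) *(4) by (rule continuous_map_compose)
    then have "openin T {a \<in> topspace T. (p \<circ> h) a \<in> {1..}}"
      using Z(4) by (rule openin_continuous_map_preimage)
    moreover have "e x \<in> topspace T" if "x \<in> topspace X" for x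
      using eK topT that by (auto simp: G_def)
    ultimately show ?thesis
      using h(2) *(6) by (intro exI [of _ "{a \<in> topspace T. (p \<circ> h) a \<in> {1..}}"]) auto
  qed
  have inj: "inj_on e (topspace X)"
  proof (rule inj_onI, rule ccontr)
    fix x y assume xy: "x \<in> topspace X" "y \<in> topspace X" "e x = e y" "x \<noteq> y"
    then obtain U where "openin X U" "(x \<notin> U) = (y \<in> U)" using X unfolding t0_space_def by metis
    then show False using sep [of U] xy by metis
  qed
  have emb: "embedding_map X T e"
    unfolding embedding_map_def
  proof (rule bijective_open_imp_homeomorphic_map)
    have im: "e ` topspace X \<subseteq> topspace T" using eK topT by (simp add: G_def)
    show "continuous_map X (subtopology T (e ` topspace X)) e"
      using cont_eT by (auto simp: continuous_map_in_subtopology)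
    show "open_map X (subtopology T (e ` topspace X)) e"
      unfolding open_map_def
    proof (intro allI impI)
      fix U assume U: "openin X U"
      then obtain V where V: "openin T V" "\<forall>x \<in> topspace X. e x \<in> V \<longleftrightarrow> x \<in> U" using sep by blast
      then have "e ` U = V \<inter> e ` topspace X" using openin_subset [OF U] by auto
      then show "openin (subtopology T (e ` topspace X)) (e ` U)"
        using V(1) by (auto simp: openin_subtopology)
    qed
    show "e ` topspace X = topspace (subtopology T (e ` topspace X))" using im by auto
  qed (rule inj)
  have gen: "generate G (e ` topspace X) = carrier G"
    using group.generate_consistent [OF grpP eK subK] by (simp add: G_def K_def)
  have "free_pt ab X G T e"
    unfolding free_pt_def
  proof (intro conjI allI impI)
    show "paratopological_group G T"
      using grpG topT t0 mult by (simp add: paratopological_group_def)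
  qed (rule comm emb gen ext; assumption)+
  then show ?thesis by (rule that)
qed

theorem free_paratopological_group_exists:
  fixes X :: "'a topology"
  assumes "t0_space X"
  shows "\<exists>(G :: (('a \<times> bool) list monoid \<times> ('a \<times> bool) list topology \<times> ('a \<Rightarrow> ('a \<times> bool) list)
      \<Rightarrow> ('a \<times> bool) list) monoid) T e. free_paratopological_group X G T e"
  using free_pt_exists [OF assms, of False] by (metis free_pt_iff(1))

theorem free_abelian_paratopological_group_exists:
  fixes X :: "'a topology"
  assumes "t0_space X"
  shows "\<exists>(G :: (('a \<times> bool) list monoid \<times> ('a \<times> bool) list topology \<times> ('a \<Rightarrow> ('a \<times> bool) list)
      \<Rightarrow> ('a \<times> bool) list) monoid) T e. free_abelian_paratopological_group X G T e"
  using free_pt_exists [OF assms, of True] by (metis free_pt_iff(2))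

end

theory Submission
  imports Defs
begin

text \<open>
  Suppose \<open>x\<^sub>0\<close> is not isolated in \<open>X\<close>, and let \<open>U\<^sub>0 \<supseteq> U\<^sub>1 \<supseteq> \<dots>\<close> be a neighbourhood base of a
  compact set \<open>K\<close> in the free group, with \<open>k \<in> K\<close>. By continuity of the multiplication there are
  points \<open>y\<^sub>n \<noteq> x\<^sub>0\<close> such that \<open>U\<^sub>n\<close> contains \<open>g\<^sub>n = (y\<^sub>n x\<^sub>0\<^sup>-\<^sup>1)\<^bsup>m\<^esup> k\<close> with \<open>m = 4\<^sup>n\<close>. Choose continuous
  \<open>f\<^sub>n : X \<rightarrow> [0, 1]\<close> with \<open>f\<^sub>n(x\<^sub>0) = 0\<close> and \<open>f\<^sub>n(y\<^sub>n) = 1\<close>, and extend \<open>\<Sum>n. f\<^sub>n / 2\<^sup>n\<close> to a continuous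
  homomorphism \<open>\<phi>\<close> into the additive group of the reals. It is bounded on \<open>K\<close>, hence on some \<open>U\<^sub>N\<close>,
  but \<open>\<phi>(g\<^sub>n) \<ge> 4\<^sup>n / 2\<^sup>n + \<phi>(k)\<close>. The multiplicities \<open>4\<^sup>n\<close> are fixed before the \<open>y\<^sub>n\<close> and \<open>f\<^sub>n\<close>,
  which is why the \<open>f\<^sub>n\<close> have to be normalised.

  Conversely, if \<open>X\<close> is discrete then the free group is discrete, as the identity map into the
  same group with the discrete topology is continuous. The argument is the same for \<open>FP(X)\<close> and
  \<open>AP(X)\<close>.
\<close>

section \<open>Continuity of products and powers\<close>

text \<open>The parameter space \<open>Z\<close> is arbitrary so that words depending on a point of
  \<open>X\<close> are covered.\<close>

lemma continuous_map_paratopological_mult: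
  assumes "paratopological_group G T" "continuous_map Z T f" "continuous_map Z T g"
  shows "continuous_map Z T (\<lambda>z. f z \<otimes>\<^bsub>G\<^esub> g z)"
proof -
  have "continuous_map (prod_topology T T) T (\<lambda>(a, b). a \<otimes>\<^bsub>G\<^esub> b)"
    using assms(1) by (simp add: paratopological_group_def)
  moreover have "continuous_map Z (prod_topology T T) (\<lambda>z. (f z, g z))"
    using assms(2,3) by (intro continuous_map_pairedI)
  ultimately have "continuous_map Z T ((\<lambda>(a, b). a \<otimes>\<^bsub>G\<^esub> b) \<circ> (\<lambda>z. (f z, g z)))"
    by (rule continuous_map_compose [rotated])
  then show ?thesis by (simp add: comp_def)
qed

lemma continuous_map_paratopological_pow:
  fixes n :: nat
  assumes "paratopological_group G T" "continuous_map Z T f"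
  shows "continuous_map Z T (\<lambda>z. f z [^]\<^bsub>G\<^esub> n)"
proof (induction n)
  case 0
  interpret group G using assms(1) by (simp add: paratopological_group_def)
  have "topspace T = carrier G" using assms(1) by (simp add: paratopological_group_def)
  then show ?case by simp
next
  case (Suc n)
  then show ?case
    using continuous_map_paratopological_mult [OF assms(1) Suc assms(2)] by simp
qed

section \<open>Discrete spaces\<close>

lemma free_pt_discrete:
  assumes G: "free_pt ab X G T e" and X: "X = discrete_topology (topspace X)"
  shows "T = discrete_topology (carrier G)"
proof -
  have para: "paratopological_group G T" and comm: "ab \<longrightarrow> comm_group G"
    and emb: "embedding_map X T e" and gen: "generate G (e ` topspace X) = carrier G"
    using G by (auto simp: free_pt_def)
  interpret group G using para by (simp add: paratopological_group_def)
  have top: "topspace T = carrier G" using para by (simp add: paratopological_group_def)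
  let ?D = "discrete_topology (carrier G)"
  have ecar: "e ` topspace X \<subseteq> carrier G"
    using gen by (metis generate.incl subsetI)
  \<comment> \<open>A product of discrete spaces is discrete, so every multiplication is
    continuous.\<close>
  have "paratopological_group G ?D"
    using t0_space_discrete_topology [of "carrier G"]
    by (auto simp: paratopological_group_def group_axioms simp flip: prod_topology_discrete_topology)
  moreover have "continuous_map X ?D e"
    using ecar by (subst X) (auto simp: Pi_iff)
  ultimately obtain h where h: "h \<in> hom G G" "continuous_map T ?D h" "\<forall>x \<in> topspace X. h (e x) = e x"
    using free_pt_extension [OF G _ comm] by blast
  interpret h: group_hom G G h by unfold_locales (rule h(1))
  \<comment> \<open>\<open>h\<close> fixes the generators, hence all of \<open>G\<close>. So the
    identity is continuous from \<open>T\<close> to \<open>?D\<close>, and each singleton is an open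
    preimage.\<close>
  have id: "h g = g" if "g \<in> generate G (e ` topspace X)" for g
    using that
  proof induction
    case (inv a)
    then show ?case using h(3) ecar by auto
  next
    case (eng a b)
    then show ?case using ecar generate_in_carrier [OF ecar] by simp
  qed (use h(3) in auto)
  have "openin T {g}" if "g \<in> carrier G" for g
  proof -
    have "openin T {a \<in> topspace T. h a \<in> {g}}"
      using h(2) that by (intro openin_continuous_map_preimage) auto
    moreover have "{a \<in> topspace T. h a \<in> {g}} = {g}"
      using id gen top that by auto
    ultimately show ?thesis by simp
  qed
  then show ?thesis
    using top discrete_topology_unique by metis
qed

lemma almost_countable_type_discrete_topology:
  assumes "A \<noteq> {}"
  shows "almost_countable_type (discrete_topology A)"
proof -
  obtain a where a: "a \<in> A" using assms by blast
  then have "countable_character_in (discrete_topology A) {a}"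
    unfolding countable_character_in_def by (intro exI [of _ "{{a}}"]) auto
  moreover have "compactin (discrete_topology A) {a}" using a by simp
  ultimately show ?thesis unfolding almost_countable_type_def by blast
qed

section \<open>Neighbourhood bases and real functions\<close>

text \<open>Intersecting the first members of an enumeration turns "some member lies in
  \<open>V\<close>" into "all late members lie in \<open>V\<close>".\<close>

lemma countable_character_in_decreasing:
  assumes "countable_character_in Y K" "K \<subseteq> topspace Y"
  obtains U :: "nat \<Rightarrow> 'a set" where "\<And>n. openin Y (U n)" "\<And>n. K \<subseteq> U n"
    "\<And>V. openin Y V \<Longrightarrow> K \<subseteq> V \<Longrightarrow> \<exists>N. \<forall>n\<ge>N. U n \<subseteq> V"
proof -
  obtain \<B> where B: "countable \<B>" "\<And>B. B \<in> \<B> \<Longrightarrow> openin Y B \<and> K \<subseteq> B"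
    "\<And>V. openin Y V \<Longrightarrow> K \<subseteq> V \<Longrightarrow> \<exists>B \<in> \<B>. B \<subseteq> V"
    using assms(1) unfolding countable_character_in_def by metis
  \<comment> \<open>\<open>from_nat_into\<close> enumerates only non-empty sets. The whole space, as
    a neighbourhood of \<open>K\<close>, contains a member.\<close>
  have ne: "\<B> \<noteq> {}" using B(3) [OF openin_topspace assms(2)] by blast
  define b where "b = from_nat_into \<B>"
  have b: "range b = \<B>" unfolding b_def by (rule range_from_nat_into [OF ne B(1)])
  show ?thesis
  proof (rule that [of "\<lambda>n. \<Inter>i\<le>n. b i"])
    show "openin Y (\<Inter>i\<le>n. b i)" for n
      by (intro openin_INT2) (use B(2) b in auto)
    show "K \<subseteq> (\<Inter>i\<le>n. b i)" for n using B(2) b by blast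
    fix V assume "openin Y V" "K \<subseteq> V"
    then obtain N where "b N \<subseteq> V" using B(3) b by blast
    then show "\<exists>N. \<forall>n\<ge>N. (\<Inter>i\<le>n. b i) \<subseteq> V" by (intro exI [of _ N]) auto
  qed
qed

text \<open>A separating function is recentred at \<open>x\<close>, rescaled and truncated. The
  bounds hold for every \<open>z\<close>, also outside \<open>X\<close>, as the series below
  requires.\<close>

lemma functionally_Hausdorff_unit_interval:
  assumes "functionally_Hausdorff X" "x \<in> topspace X" "y \<in> topspace X" "x \<noteq> y"
  obtains f :: "'a \<Rightarrow> real" where "continuous_map X euclideanreal f"
    "\<And>z. 0 \<le> f z" "\<And>z. f z \<le> 1" "f x = 0" "f y = 1"
proof -
  obtain f :: "'a \<Rightarrow> real" where f: "continuous_map X euclideanreal f" "f x \<noteq> f y"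
    using assms unfolding functionally_Hausdorff_def by blast
  show ?thesis
  proof (rule that [of "\<lambda>z. min 1 (\<bar>f z - f x\<bar> / \<bar>f y - f x\<bar>)"])
    show "continuous_map X euclideanreal (\<lambda>z. min 1 (\<bar>f z - f x\<bar> / \<bar>f y - f x\<bar>))"
      using f by (intro continuous_map_real_min continuous_map_real_divide continuous_map_real_abs
          continuous_map_diff) auto
  qed (use f in auto)
qed

lemma continuous_map_suminf_geometric:
  fixes f :: "nat \<Rightarrow> 'a \<Rightarrow> real"
  assumes "\<And>n. continuous_map X euclideanreal (f n)" "\<And>n z. \<bar>f n z\<bar> \<le> 1"
  shows "continuous_map X euclideanreal (\<lambda>z. \<Sum>n. f n z / 2 ^ n)"
proof -
  have "uniform_limit (topspace X) (\<lambda>n z. \<Sum>i<n. f i z / 2 ^ i) (\<lambda>z. \<Sum>i. f i z / 2 ^ i) sequentially"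
  proof (rule Weierstrass_m_test)
    show "norm (f n z / 2 ^ n) \<le> (1 / 2) ^ n" for n z
      using assms(2) [of n z] by (simp add: power_divide divide_right_mono)
  qed (simp add: summable_geometric)
  then have lim: "\<forall>\<^sub>F n in sequentially. \<forall>z\<in>topspace X. (\<Sum>i. f i z / 2 ^ i) \<in> UNIV \<and>
      dist (\<Sum>i<n. f i z / 2 ^ i) (\<Sum>i. f i z / 2 ^ i) < \<epsilon>" if "\<epsilon> > 0" for \<epsilon>
    using that by (auto dest: uniform_limitD)
  have "continuous_map X euclideanreal (\<lambda>z. \<Sum>i<n. f i z / 2 ^ i)" for n
    by (intro continuous_map_sum continuous_map_real_divide assms) auto
  \<comment> \<open>\<open>Met_TC.mtopology\<close> is the Euclidean topology, seen as that of a
    metric space, where uniform limits of continuous maps are continuous.\<close>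
  then have "\<forall>\<^sub>F n in sequentially. continuous_map X Met_TC.mtopology (\<lambda>z. \<Sum>i<n. f i z / 2 ^ i)"
    by simp
  then have "continuous_map X Met_TC.mtopology (\<lambda>z. \<Sum>i. f i z / 2 ^ i)"
    using lim by (rule Met_TC.continuous_map_uniform_limit) auto
  then show ?thesis by simp
qed

section \<open>Homomorphisms to the reals and non-isolated points\<close>

text \<open>The additive reals form an Abelian topological group, so this one target serves both
  values of \<open>ab\<close>.\<close>

lemma free_pt_real_extension:
  fixes f :: "'a \<Rightarrow> real"
  assumes G: "free_pt ab X G T e" and f: "continuous_map X euclideanreal f"
  obtains \<phi> :: "'g \<Rightarrow> real" where "continuous_map T euclideanreal \<phi>"
    "\<And>x. x \<in> topspace X \<Longrightarrow> \<phi> (e x) = f x"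
    "\<And>a b. a \<in> carrier G \<Longrightarrow> b \<in> carrier G \<Longrightarrow> \<phi> (a \<otimes>\<^bsub>G\<^esub> b) = \<phi> a + \<phi> b"
    "\<And>a. a \<in> carrier G \<Longrightarrow> \<phi> (inv\<^bsub>G\<^esub> a) = - \<phi> a"
    "\<And>a (n :: nat). a \<in> carrier G \<Longrightarrow> \<phi> (a [^]\<^bsub>G\<^esub> n) = real n * \<phi> a"
proof -
  define R :: "real monoid" where "R = \<lparr>carrier = UNIV, monoid.mult = (+), one = 0\<rparr>"
  have comm: "comm_group R"
  proof (rule comm_groupI)
    show "\<exists>y\<in>carrier R. y \<otimes>\<^bsub>R\<^esub> x = \<one>\<^bsub>R\<^esub>" for x
      by (rule bexI [of _ "- x"]) (simp_all add: R_def)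
  qed (simp_all add: R_def)
  have "continuous_map (prod_topology euclideanreal euclideanreal) euclideanreal (\<lambda>x. fst x + snd x)"
    by (intro continuous_map_add continuous_map_fst continuous_map_snd)
  then have "paratopological_group R euclideanreal"
    using comm Hausdorff_imp_t0_space [of euclideanreal]
    by (auto simp: paratopological_group_def R_def case_prod_unfold comm_group.axioms(2)
      simp del: prod_topology_euclidean)
  then obtain \<phi> where \<phi>: "\<phi> \<in> hom G R" "continuous_map T euclideanreal \<phi>" 
      "\<forall>x \<in> topspace X. \<phi> (e x) = f x"
    using free_pt_extension [OF G _ _ f] comm by blast
  interpret G: group G using G by (simp add: free_pt_def paratopological_group_def)
  have mult: "\<phi> (a \<otimes>\<^bsub>G\<^esub> b) = \<phi> a + \<phi> b" if "a \<in> carrier G" "b \<in> carrier G" for a b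
    using hom_mult [OF \<phi>(1) that] by (simp add: R_def)
  have one: "\<phi> \<one>\<^bsub>G\<^esub> = 0" using mult [of "\<one>\<^bsub>G\<^esub>" "\<one>\<^bsub>G\<^esub>"] by simp
  show ?thesis
  proof (rule that [of \<phi>])
    show "\<phi> (inv\<^bsub>G\<^esub> a) = - \<phi> a" if "a \<in> carrier G" for a
      using mult [of "inv\<^bsub>G\<^esub> a" a] that one by simp
    show "\<phi> (a [^]\<^bsub>G\<^esub> n) = real n * \<phi> a" if "a \<in> carrier G" for a and n :: nat
      by (induction n) (use one mult that in \<open>auto simp: algebra_simps\<close>)
  qed (use \<phi> mult in auto)
qed

text \<open>The map \<open>\<psi>\<close> below is continuous and sends \<open>x\<close> to
  \<open>k\<close>, so the preimage of \<open>U\<close> is an open set around \<open>x\<close>,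
  which cannot be \<open>{x}\<close>. Only the constant \<open>e x\<close> is inverted, so
  continuity of multiplication suffices.\<close>

lemma free_pt_approximating_powers:
  fixes m :: nat
  assumes G: "free_pt ab X G T e" and x: "x \<in> topspace X" "\<not> openin X {x}"
    and U: "openin T U" "k \<in> U"
  shows "\<exists>y \<in> topspace X. y \<noteq> x \<and> (e y \<otimes>\<^bsub>G\<^esub> inv\<^bsub>G\<^esub> e x) [^]\<^bsub>G\<^esub> m \<otimes>\<^bsub>G\<^esub> k \<in> U"
proof -
  have para: "paratopological_group G T" and emb: "embedding_map X T e"
    using G by (auto simp: free_pt_def)
  interpret group G using para by (simp add: paratopological_group_def)
  have top: "topspace T = carrier G" using para by (simp add: paratopological_group_def)
  have e: "continuous_map X T e"
    using continuous_map_into_fulltopology [OF homeomorphic_imp_continuous_map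
      [OF emb [unfolded embedding_map_def]]] .
  have ex: "e x \<in> carrier G"
    using e x(1) top by (metis continuous_map_image_subset_topspace image_subset_iff)
  have k: "k \<in> carrier G" using U top openin_subset by blast
  define \<psi> where "\<psi> y = (e y \<otimes>\<^bsub>G\<^esub> inv\<^bsub>G\<^esub> e x) [^]\<^bsub>G\<^esub> m \<otimes>\<^bsub>G\<^esub> k" for y
  have "continuous_map X T \<psi>"
    unfolding \<psi>_def using para e ex k top
    by (intro continuous_map_paratopological_mult continuous_map_paratopological_pow) auto
  then have op: "openin X {y \<in> topspace X. \<psi> y \<in> U}"
    using U(1) by (rule openin_continuous_map_preimage)
  have "\<psi> x = k" using ex k by (simp add: \<psi>_def)
  then have "x \<in> {y \<in> topspace X. \<psi> y \<in> U}" using x U by simp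
  moreover have "{y \<in> topspace X. \<psi> y \<in> U} \<noteq> {x}" using op x(2) by metis
  ultimately obtain y where "y \<in> topspace X" "\<psi> y \<in> U" "y \<noteq> x" by blast
  then show ?thesis by (auto simp: \<psi>_def)
qed

lemma free_pt_almost_countable_type_imp_discrete:
  assumes G: "free_pt ab X G T e" and X: "functionally_Hausdorff X" and T: "almost_countable_type T"
  shows "X = discrete_topology (topspace X)"
proof (rule ccontr)
  assume "X \<noteq> discrete_topology (topspace X)"
  then obtain x where x: "x \<in> topspace X" "\<not> openin X {x}"
    using discrete_topology_unique [of "topspace X" X] by metis
  have para: "paratopological_group G T" and gen: "generate G (e ` topspace X) = carrier G"
    using G by (auto simp: free_pt_def)
  interpret group G using para by (simp add: paratopological_group_def)
  have top: "topspace T = carrier G" using para by (simp add: paratopological_group_def)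
  have ecar: "e y \<in> carrier G" if "y \<in> topspace X" for y
    using gen that by (metis generate.incl imageI)
  obtain K where K: "K \<noteq> {}" "compactin T K" "countable_character_in T K"
    using T unfolding almost_countable_type_def by blast
  have KT: "K \<subseteq> topspace T" using K(2) by (rule compactin_subset_topspace)
  obtain k where k: "k \<in> K" using K(1) by blast
  then have kG: "k \<in> carrier G" using KT top by blast
  obtain U where U: "\<And>n. openin T (U n)" "\<And>n. K \<subseteq> U n"
    "\<And>V. openin T V \<Longrightarrow> K \<subseteq> V \<Longrightarrow> \<exists>N :: nat. \<forall>n\<ge>N. U n \<subseteq> V"
    using countable_character_in_decreasing [OF K(3) KT] by metis
  have "\<forall>n. \<exists>y. y \<in> topspace X \<and> y \<noteq> x \<and>
      (e y \<otimes>\<^bsub>G\<^esub> inv\<^bsub>G\<^esub> e x) [^]\<^bsub>G\<^esub> (4 ^ n :: nat) \<otimes>\<^bsub>G\<^esub> k \<in> U n"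
    using free_pt_approximating_powers [OF G x U(1)] U(2) k by (meson subsetD)
  then obtain y where y: "\<And>n. y n \<in> topspace X" "\<And>n. y n \<noteq> x"
    "\<And>n. (e (y n) \<otimes>\<^bsub>G\<^esub> inv\<^bsub>G\<^esub> e x) [^]\<^bsub>G\<^esub> (4 ^ n :: nat) \<otimes>\<^bsub>G\<^esub> k \<in> U n"
    by metis
  have "\<forall>n. \<exists>f :: 'a \<Rightarrow> real. continuous_map X euclideanreal f \<and> (\<forall>z. 0 \<le> f z) \<and> (\<forall>z. f z \<le> 1) \<and>
      f x = 0 \<and> f (y n) = 1"
    using functionally_Hausdorff_unit_interval [OF X x(1) y(1)] y(2) by metis
  then obtain f :: "nat \<Rightarrow> 'a \<Rightarrow> real" where f: "\<And>n. continuous_map X euclideanreal (f n)"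
    "\<And>n z. 0 \<le> f n z" "\<And>n z. f n z \<le> 1" "\<And>n. f n x = 0" "\<And>n. f n (y n) = 1"
    by metis
  define F where "F z = (\<Sum>n. f n z / 2 ^ n)" for z
  have F: "continuous_map X euclideanreal F"
    unfolding F_def using f by (intro continuous_map_suminf_geometric) (auto simp: abs_le_iff intro: order_trans)
  obtain \<phi> where \<phi>: "continuous_map T euclideanreal \<phi>"
    "\<And>x. x \<in> topspace X \<Longrightarrow> \<phi> (e x) = F x"
    "\<And>a b. a \<in> carrier G \<Longrightarrow> b \<in> carrier G \<Longrightarrow> \<phi> (a \<otimes>\<^bsub>G\<^esub> b) = \<phi> a + \<phi> b"
    "\<And>a. a \<in> carrier G \<Longrightarrow> \<phi> (inv\<^bsub>G\<^esub> a) = - \<phi> a"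
    "\<And>a (n :: nat). a \<in> carrier G \<Longrightarrow> \<phi> (a [^]\<^bsub>G\<^esub> n) = real n * \<phi> a"
    by (rule free_pt_real_extension [OF G F]) (rule that)
  have Fx: "F x = 0" using f(4) by (simp add: F_def)
  \<comment> \<open>All terms are non-negative, so the sum is at least its term of index
    \<open>n\<close>.\<close>
  have Fy: "F (y n) \<ge> 1 / 2 ^ n" for n
  proof -
    have "summable (\<lambda>i. f i (y n) / 2 ^ i)"
    proof (rule summable_comparison_test')
      show "norm (f i (y n) / 2 ^ i) \<le> (1 / 2) ^ i" for i
        using f(2,3) [of i "y n"] by (simp add: power_divide divide_right_mono)
    qed (simp add: summable_geometric)
    from sum_le_suminf [OF this, of "{n}"] show ?thesis
      using f(2,5) by (simp add: F_def)
  qed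
  have "compactin euclideanreal (\<phi> ` K)" using K(2) \<phi>(1) by (rule image_compactin)
  then have "bounded (\<phi> ` K)" by (simp add: compact_imp_bounded)
  then obtain M where M: "\<And>a. a \<in> K \<Longrightarrow> \<phi> a \<le> M"
    unfolding bounded_real by (meson abs_le_D1 imageI)
  \<comment> \<open>The bound \<open>M + 1\<close> makes the strict inequality hold on all of
    \<open>K\<close>, giving an open set that contains \<open>K\<close>.\<close>
  have "openin T {a \<in> topspace T. \<phi> a \<in> {..<M + 1}}"
    using \<phi>(1) by (intro openin_continuous_map_preimage) auto
  moreover have "K \<subseteq> {a \<in> topspace T. \<phi> a \<in> {..<M + 1}}" using M KT by fastforce
  ultimately obtain N where N: "\<And>n. n \<ge> N \<Longrightarrow> U n \<subseteq> {a \<in> topspace T. \<phi> a \<in> {..<M + 1}}"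
    using U(3) by blast
  have lower: "2 ^ n + \<phi> k < M + 1" if "n \<ge> N" for n
  proof -
    have "\<phi> ((e (y n) \<otimes>\<^bsub>G\<^esub> inv\<^bsub>G\<^esub> e x) [^]\<^bsub>G\<^esub> (4 ^ n :: nat) \<otimes>\<^bsub>G\<^esub> k) = 4 ^ n * F (y n) + \<phi> k"
      using \<phi> x(1) y(1) ecar kG Fx by simp
    moreover have "(2 :: real) ^ n \<le> 4 ^ n * F (y n)"
    proof -
      have "(4 :: real) ^ n = 2 ^ n * 2 ^ n" by (simp flip: power_mult_distrib)
      then have "(2 :: real) ^ n = 4 ^ n * (1 / 2 ^ n)" by simp
      also have "\<dots> \<le> 4 ^ n * F (y n)" using Fy by (intro mult_left_mono) auto
      finally show ?thesis .
    qed
    ultimately show ?thesis using y(3) [of n] N [OF that] by auto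
  qed
  obtain n where n: "M + 1 - \<phi> k < 2 ^ n" using real_arch_pow [of 2] by auto
  \<comment> \<open>The \<open>n\<close> just found may lie below \<open>N\<close>; passing to the
    maximum keeps the inequality.\<close>
  have "(2 :: real) ^ n \<le> 2 ^ max n N" by (intro power_increasing) auto
  with lower [of "max n N"] n show False by simp
qed

lemma free_pt_almost_countable_type_iff:
  assumes "free_pt ab X G T e" "functionally_Hausdorff X"
  shows "almost_countable_type T \<longleftrightarrow> X = discrete_topology (topspace X)"
proof
  assume "X = discrete_topology (topspace X)"
  then have "T = discrete_topology (carrier G)" by (rule free_pt_discrete [OF assms(1)])
  \<comment> \<open>The identity lies in \<open>G\<close> even when \<open>X\<close> is
    empty.\<close>
  moreover have "carrier G \<noteq> {}"
    using assms(1) by (auto simp: free_pt_def paratopological_group_def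
      dest!: group.is_monoid monoid.one_closed)
  ultimately show "almost_countable_type T" by (simp add: almost_countable_type_discrete_topology)
qed (rule free_pt_almost_countable_type_imp_discrete [OF assms])

theorem theorem4p3:
  fixes X :: "'a topology"
    and FP :: "'g monoid" and T\<^sub>F :: "'g topology" and e\<^sub>F :: "'a \<Rightarrow> 'g"
    and AP :: "'h monoid" and T\<^sub>A :: "'h topology" and e\<^sub>A :: "'a \<Rightarrow> 'h"
  assumes "functionally_Hausdorff X"
    and "free_paratopological_group X FP T\<^sub>F e\<^sub>F"
    and "free_abelian_paratopological_group X AP T\<^sub>A e\<^sub>A"
  shows "(almost_countable_type T\<^sub>F \<longleftrightarrow> almost_countable_type T\<^sub>A) \<and>
         (almost_countable_type T\<^sub>A \<longleftrightarrow> X = discrete_topology (topspace X))"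
  \<comment> \<open>Each group is compared with discreteness of \<open>X\<close>, through one value
    of the flag.\<close>
  using assms free_pt_almost_countable_type_iff [of False X FP T\<^sub>F e\<^sub>F]
    free_pt_almost_countable_type_iff [of True X AP T\<^sub>A e\<^sub>A]
  by (simp add: free_pt_iff)

end
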